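(* The K-shell protocol (written out in the context) for performing K-shell decomposition is data-oblivious.
   Context: **Graphs and representation.** $G(V,E)$ is a graph with vertex set $V=\{1,\dots,n\}$ and $m=|E|$ edges; edges are directed (ordered pairs of vertices), an undirected graph being included as a graph with bidirectional edges. The input is given in the edgelist representation $(\mathcal{E},Idx)$. $\mathcal{E}$ is an array of length $m+1$ containing the concatenated adjacency lists of all vertices (in the order $1,2,\dots,n$) and an empty element at the end. $Idx$ is an array of length $n$: $Idx[u]=i$ if out-degree$(u)\neq 0$ and $\mathcal{E}[i]$ is the first neighbour of $u$ in $\mathcal{E}$; $Idx[u]=Idx[u+1]$ if $u\neq n$ and out-degree$(u)=0$; $Idx[u]=m+1$ if $u=n$ and out-degree$(u)=0$. Convention: $Idx[n+1]=m+1$. **K-shell decomposition.** The $k$-core of $G$ is the subgraph induced by the largest vertex set $V_k\subseteq V$ such that every $v\in V_k$ has degree at least $k$ in this subgraph; $shell(v)=i$ if $v$ belongs to the $i$-core but not to the $(i+1)$-core. **Data-obliviousness.** An algorithm is data-oblivious if its control flow and memory access pattern do not leak any information about the input other than its length, here the number $n$ of nodes and the number $m$ of edges. Data values are public or private; control flow and access pattern may depend on public values as well as on the input length. Addition, subtraction, multiplication, division, comparison and equality check are assumed as primitive operations. Arrays may be stored in an Oblivious RAM (ORAM), which allows an array to be accessed at a secret index data-obliviously. The if-else construct stands for its oblivious variant: both branches are executed one after the other, only one of them taking effect and the other being executed in a dummy fashion. A data-oblivious sorting primitive is assumed. **The K-shell protocol.** Input: $(\mathcal{E},Idx)$. Output: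 $shell(v)$ for each $v\in V$, namely the final value $deg[v]$. The arrays $deg,bin,vert,pos,\mathcal{E},Idx$ are stored in the ORAM; $n$, $m$, the constants, $i$ and $iter$ are marked public; $start,temp,v,j,u,w,du,pu,pw$ are marked private. 1. $deg[i]\leftarrow 0$ for $1\le i\le n$; $vert[i]\leftarrow i$ for $1\le i\le n$; $bin[i]\leftarrow 0$ for $1\le i\le n-1$. 2. For $i=1$ to $n$: $deg[i]\leftarrow Idx[i+1]-Idx[i]$; $bin[deg[i]]\leftarrow bin[deg[i]]+1$. 3. $start\leftarrow 1$. For $i=1$ to $n$: $temp\leftarrow bin[i]$; $bin[i]\leftarrow start$; $start\leftarrow start+temp$. 4. Sort $vert$ with respect to the degrees $deg$ (by the data-oblivious sorting primitive). Set $pos[vert[i]]\leftarrow i$ for $1\le i\le n$. 5. $i\leftarrow 1$; $v\leftarrow vert[i]$; $j\leftarrow Idx[v]$. 6. For $iter=1$ to $n+m-1$: - If $j==Idx[v+1]$: $i\leftarrow i+1$; $v\leftarrow vert[i]$; $j\leftarrow Idx[v]$. - Else: $u\leftarrow\mathcal{E}[j]$. If $deg[u]>deg[v]$: { $du\leftarrow deg[u]$; $pu\leftarrow pos[u]$; $pw\leftarrow bin[du]$; $w\leftarrow vert[pw]$; if $u\neq w$: { $pos[u]\leftarrow pw$; $vert[pu]\leftarrow w$; $pos[w]\leftarrow pu$; $vert[pw]\leftarrow u$ }; $bin[du]\leftarrow bin[du]+1$; $deg[u]\leftarrow deg[u]-1$ }. Then (still in the else branch) $j\leftarrow j+1$.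 *)

theory Defs
  imports "HOL-Library.Multiset"
begin

section \<open>Programs with an observable trace\<close>

text \<open>
  A small imperative language over integer scalars (names in \<open>'v\<close>) and integer arrays (names in
  \<open>'a\<close>). It contains leaking constructs as well as oblivious ones, so being data-oblivious is a
  genuine property of a program: \<open>If\<close> reveals which branch is taken, \<open>For\<close> reveals its bounds, and
  an access to an array outside the ORAM reveals the index.
\<close>

datatype arith_op = Plus | Minus | Times | Divide
datatype cmp_op = Equal | NotEqual | Greater

datatype ('v, 'a) expr =
    Const int
  | Var 'v
  | Read 'a "('v, 'a) expr"
  | Arith arith_op "('v, 'a) expr" "('v, 'a) expr"

datatype ('v, 'a) cond = Compare cmp_op "('v, 'a) expr" "('v, 'a) expr"

datatype ('v, 'a) com =
    Skip
  | Assign 'v "('v, 'a) expr"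
  | Store 'a "('v, 'a) expr" "('v, 'a) expr"
  | Seq "('v, 'a) com" "('v, 'a) com"  (infixr \<open>;;\<close> 60)
  | If "('v, 'a) cond" "('v, 'a) com" "('v, 'a) com"
  | ObliviousIf "('v, 'a) cond" "('v, 'a) com" "('v, 'a) com"
  | For 'v "('v, 'a) expr" "('v, 'a) expr" "('v, 'a) com"
  | ObliviousSort 'a 'a "('v, 'a) expr" "('v, 'a) expr"
      \<comment> \<open>\<open>ObliviousSort A K lo hi\<close> sorts \<open>A[lo..hi]\<close> with respect to the keys \<open>K[A[k]]\<close>\<close>

text \<open>
  Memory is total: array cells outside the intended index range exist and hold arbitrary values.
\<close>

record ('v, 'a) state =
  scalars :: "'v \<Rightarrow> int"
  arrays :: "'a \<Rightarrow> int \<Rightarrow> int"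

text \<open>
  What an observer sees. A scalar lives at a fixed location, so accessing it reveals its name but not
  its value. An ORAM access reveals which array is accessed but not the index, the value, or
  whether it is a read or a write; this is the interface of the ORAM. The sorting primitive
  reveals the arrays and the range only. The sequence of executed instructions is determined by the
  program text together with the \<open>Branch\<close> and \<open>LoopRange\<close> events.
\<close>

datatype ('v, 'a) event =
    ScalarAccess 'v
  | PlainAccess 'a int
  | OramAccess 'a
  | ArithOp arith_op
  | CmpOp cmp_op
  | Branch bool
  | LoopRange int int
  | SortRange 'a 'a int int

definition array_access :: "'a set \<Rightarrow> 'a \<Rightarrow> int \<Rightarrow> ('v, 'a) event" where
  "array_access oram A k = (if A \<in> oram then OramAccess A else PlainAccess A k)"

fun arith :: "arith_op \<Rightarrow> int \<Rightarrow> int \<Rightarrow> int" where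
  "arith Plus x y = x + y"
| "arith Minus x y = x - y"
| "arith Times x y = x * y"
| "arith Divide x y = x div y"

fun compare :: "cmp_op \<Rightarrow> int \<Rightarrow> int \<Rightarrow> bool" where
  "compare Equal x y \<longleftrightarrow> x = y"
| "compare NotEqual x y \<longleftrightarrow> x \<noteq> y"
| "compare Greater x y \<longleftrightarrow> x > y"

primrec eval_expr :: "('v, 'a) expr \<Rightarrow> ('v, 'a) state \<Rightarrow> int" where
  "eval_expr (Const c) s = c"
| "eval_expr (Var x) s = scalars s x"
| "eval_expr (Read A e) s = arrays s A (eval_expr e s)"
| "eval_expr (Arith f e1 e2) s = arith f (eval_expr e1 s) (eval_expr e2 s)"

primrec trace_expr :: "'a set \<Rightarrow> ('v, 'a) expr \<Rightarrow> ('v, 'a) state \<Rightarrow> ('v, 'a) event list" where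
  "trace_expr oram (Const c) s = []"
| "trace_expr oram (Var x) s = [ScalarAccess x]"
| "trace_expr oram (Read A e) s = trace_expr oram e s @ [array_access oram A (eval_expr e s)]"
| "trace_expr oram (Arith f e1 e2) s = trace_expr oram e1 s @ trace_expr oram e2 s @ [ArithOp f]"

primrec eval_cond :: "('v, 'a) cond \<Rightarrow> ('v, 'a) state \<Rightarrow> bool" where
  "eval_cond (Compare f e1 e2) s = compare f (eval_expr e1 s) (eval_expr e2 s)"

primrec trace_cond :: "'a set \<Rightarrow> ('v, 'a) cond \<Rightarrow> ('v, 'a) state \<Rightarrow> ('v, 'a) event list" where
  "trace_cond oram (Compare f e1 e2) s = trace_expr oram e1 s @ trace_expr oram e2 s @ [CmpOp f]"

definition set_scalar :: "'v \<Rightarrow> int \<Rightarrow> ('v, 'a) state \<Rightarrow> ('v, 'a) state" where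
  "set_scalar x c s = s\<lparr>scalars := (scalars s)(x := c)\<rparr>"

definition set_cell :: "'a \<Rightarrow> int \<Rightarrow> int \<Rightarrow> ('v, 'a) state \<Rightarrow> ('v, 'a) state" where
  "set_cell A k c s = s\<lparr>arrays := (arrays s)(A := (arrays s A)(k := c))\<rparr>"

text \<open>A sorting primitive takes a key function and a list; how it treats ties is left open.\<close>

type_synonym sorter = "(int \<Rightarrow> int) \<Rightarrow> int list \<Rightarrow> int list"

definition sorting_primitive :: "sorter \<Rightarrow> bool" where
  "sorting_primitive srt \<longleftrightarrow>
     (\<forall>key xs. mset (srt key xs) = mset xs \<and> sorted (map key (srt key xs)))"

definition sort_range ::
    "sorter \<Rightarrow> 'a \<Rightarrow> 'a \<Rightarrow> int \<Rightarrow> int \<Rightarrow> ('v, 'a) state \<Rightarrow> ('v, 'a) state" where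
  "sort_range srt A K lo hi s =
     (let xs = srt (arrays s K) (map (arrays s A) [lo..hi])
      in s\<lparr>arrays := (arrays s)(A :=
           (\<lambda>k. if lo \<le> k \<and> k \<le> hi then xs ! nat (k - lo) else arrays s A k))\<rparr>)"

text \<open>
  The flag says whether the command takes effect. With flag \<open>False\<close> it is executed in a dummy
  fashion: the same instructions and accesses are performed, but no write changes the state.
\<close>

primrec exec ::
    "sorter \<Rightarrow> 'a set \<Rightarrow> ('v, 'a) com \<Rightarrow> bool \<Rightarrow> ('v, 'a) state
       \<Rightarrow> ('v, 'a) state \<times> ('v, 'a) event list" where
  "exec srt oram Skip act s = (s, [])"
| "exec srt oram (Assign x e) act s =
     ((if act then set_scalar x (eval_expr e s) s else s),
      trace_expr oram e s @ [ScalarAccess x])"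
| "exec srt oram (Store A i e) act s =
     ((if act then set_cell A (eval_expr i s) (eval_expr e s) s else s),
      trace_expr oram i s @ trace_expr oram e s @ [array_access oram A (eval_expr i s)])"
| "exec srt oram (c1 ;; c2) act s =
     (let (s1, t1) = exec srt oram c1 act s;
          (s2, t2) = exec srt oram c2 act s1
      in (s2, t1 @ t2))"
| "exec srt oram (If b c1 c2) act s =
     (let (s', t) = (if eval_cond b s then exec srt oram c1 act s else exec srt oram c2 act s)
      in (s', trace_cond oram b s @ [Branch (eval_cond b s)] @ t))"
| "exec srt oram (ObliviousIf b c1 c2) act s =
     (let (s1, t1) = exec srt oram c1 (act \<and> eval_cond b s) s;
          (s2, t2) = exec srt oram c2 (act \<and> \<not> eval_cond b s) s1
      in (s2, trace_cond oram b s @ t1 @ t2))"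
| "exec srt oram (For x lo hi c) act s =
     fold (\<lambda>k (s1, t1).
             let (s2, t2) = exec srt oram c act (if act then set_scalar x k s1 else s1)
             in (s2, t1 @ [ScalarAccess x] @ t2))
       [eval_expr lo s..eval_expr hi s]
       (s, trace_expr oram lo s @ trace_expr oram hi s
             @ [LoopRange (eval_expr lo s) (eval_expr hi s)])"
| "exec srt oram (ObliviousSort A K lo hi) act s =
     ((if act then sort_range srt A K (eval_expr lo s) (eval_expr hi s) s else s),
      trace_expr oram lo s @ trace_expr oram hi s
        @ [SortRange A K (eval_expr lo s) (eval_expr hi s)])"

definition trace ::
    "sorter \<Rightarrow> 'a set \<Rightarrow> ('v, 'a) com \<Rightarrow> ('v, 'a) state \<Rightarrow> ('v, 'a) event list" where
  "trace srt oram c s = snd (exec srt oram c True s)"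

text \<open>
  \<open>input l s\<close> means that \<open>s\<close> is an initial state holding a valid input of length \<open>l\<close>.
  The trace may depend on the length and on nothing else.
\<close>

definition data_oblivious ::
    "sorter \<Rightarrow> 'a set \<Rightarrow> ('l \<Rightarrow> ('v, 'a) state \<Rightarrow> bool) \<Rightarrow> ('v, 'a) com \<Rightarrow> bool" where
  "data_oblivious srt oram input c \<longleftrightarrow>
     (\<forall>l s s'. input l s \<longrightarrow> input l s' \<longrightarrow> trace srt oram c s = trace srt oram c s')"


section \<open>Graphs in edgelist representation\<close>

definition is_graph :: "nat \<Rightarrow> nat \<Rightarrow> (nat \<times> nat) set \<Rightarrow> bool" where
  "is_graph n m E \<longleftrightarrow> E \<subseteq> {1..n} \<times> {1..n} \<and> card E = m"

definition out_degree :: "(nat \<times> nat) set \<Rightarrow> nat \<Rightarrow> nat" where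
  "out_degree E u = card {w. (u, w) \<in> E}"

text \<open>
  Array positions are 1-based and list positions 0-based, so position \<open>i\<close> of an array is entry
  \<open>i - 1\<close> of the list. The adjacency lists may be ordered arbitrarily. The empty element at the
  end of the edge array is encoded by \<open>0\<close>, which is not a vertex.
\<close>

definition edgelist_representation ::
    "nat \<Rightarrow> nat \<Rightarrow> (nat \<times> nat) set \<Rightarrow> nat list \<Rightarrow> nat list \<Rightarrow> bool" where
  "edgelist_representation n m E es idx \<longleftrightarrow>
     (\<exists>adj :: nat \<Rightarrow> nat list.
        (\<forall>u\<in>{1..n}. distinct (adj u) \<and> set (adj u) = {w. (u, w) \<in> E}) \<and>
        es = concat (map adj [1..<n + 1]) @ [0] \<and>
        length idx = n \<and>
        (\<forall>u\<in>{1..n}. idx ! (u - 1) =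
           (if out_degree E u \<noteq> 0 then length (concat (map adj [1..<u])) + 1
            else if u \<noteq> n then idx ! u
            else m + 1)))"


section \<open>The K-shell protocol\<close>

datatype kvar = N | M | I | Iter | Start | Temp | V | J | U | W | DU | PU | PW

datatype karr = Deg | Bin | Vert | Pos | Edges | Idx

definition kshell_oram :: "karr set" where
  "kshell_oram = {Deg, Bin, Vert, Pos, Edges, Idx}"

abbreviation plus_expr (infixl \<open>[+]\<close> 65) where "e1 [+] e2 \<equiv> Arith Plus e1 e2"
abbreviation minus_expr (infixl \<open>[-]\<close> 65) where "e1 [-] e2 \<equiv> Arith Minus e1 e2"

definition kshell_init :: "(kvar, karr) com" where
  "kshell_init =
     For I (Const 1) (Var N) (Store Deg (Var I) (Const 0));;
     For I (Const 1) (Var N) (Store Vert (Var I) (Var I));;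
     For I (Const 1) (Var N [-] Const 1) (Store Bin (Var I) (Const 0))"

definition kshell_degrees :: "(kvar, karr) com" where
  "kshell_degrees =
     For I (Const 1) (Var N)
       (Store Deg (Var I) (Read Idx (Var I [+] Const 1) [-] Read Idx (Var I));;
        Store Bin (Read Deg (Var I)) (Read Bin (Read Deg (Var I)) [+] Const 1))"

definition kshell_bins :: "(kvar, karr) com" where
  "kshell_bins =
     Assign Start (Const 1);;
     For I (Const 1) (Var N)
       (Assign Temp (Read Bin (Var I));;
        Store Bin (Var I) (Var Start);;
        Assign Start (Var Start [+] Var Temp))"

definition kshell_sort :: "(kvar, karr) com" where
  "kshell_sort =
     ObliviousSort Vert Deg (Const 1) (Var N);;
     For I (Const 1) (Var N) (Store Pos (Read Vert (Var I)) (Var I))"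

definition kshell_swap :: "(kvar, karr) com" where
  "kshell_swap =
     Store Pos (Var U) (Var PW);;
     Store Vert (Var PU) (Var W);;
     Store Pos (Var W) (Var PU);;
     Store Vert (Var PW) (Var U)"

definition kshell_decrease :: "(kvar, karr) com" where
  "kshell_decrease =
     Assign DU (Read Deg (Var U));;
     Assign PU (Read Pos (Var U));;
     Assign PW (Read Bin (Var DU));;
     Assign W (Read Vert (Var PW));;
     ObliviousIf (Compare NotEqual (Var U) (Var W)) kshell_swap Skip;;
     Store Bin (Var DU) (Read Bin (Var DU) [+] Const 1);;
     Store Deg (Var U) (Read Deg (Var U) [-] Const 1)"

definition kshell_main :: "(kvar, karr) com" where
  "kshell_main =
     Assign I (Const 1);;
     Assign V (Read Vert (Var I));;
     Assign J (Read Idx (Var V));;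
     For Iter (Const 1) (Var N [+] Var M [-] Const 1)
       (ObliviousIf (Compare Equal (Var J) (Read Idx (Var V [+] Const 1)))
         (Assign I (Var I [+] Const 1);;
          Assign V (Read Vert (Var I));;
          Assign J (Read Idx (Var V)))
         (Assign U (Read Edges (Var J));;
          ObliviousIf (Compare Greater (Read Deg (Var U)) (Read Deg (Var V)))
            kshell_decrease Skip;;
          Assign J (Var J [+] Const 1)))"

definition kshell_protocol :: "(kvar, karr) com" where
  "kshell_protocol =
     kshell_init;; kshell_degrees;; kshell_bins;; kshell_sort;; kshell_main"

text \<open>
  The cell \<open>Idx[n + 1]\<close> holds \<open>m + 1\<close> by convention. All scalars and array cells not mentioned
  here are uninitialised and hence arbitrary.
\<close>

definition kshell_input :: "nat \<times> nat \<Rightarrow> (kvar, karr) state \<Rightarrow> bool" where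
  "kshell_input = (\<lambda>(n, m) s.
     \<exists>E es idx. is_graph n m E \<and> edgelist_representation n m E es idx \<and>
       scalars s N = int n \<and> scalars s M = int m \<and>
       (\<forall>k\<in>{1..m + 1}. arrays s Edges (int k) = int (es ! (k - 1))) \<and>
       (\<forall>u\<in>{1..n}. arrays s Idx (int u) = int (idx ! (u - 1))) \<and>
       arrays s Idx (int (n + 1)) = int (m + 1))"

end

theory Submission
  imports Defs
begin

text \<open>
  The values of \<open>N\<close> and \<open>M\<close> are determined by the length of the input and the protocol never
  assigns to them. Every loop bound and sorting range is an expression over these two scalars, every
  array lives in the ORAM, and every conditional is oblivious. A syntactic check of these conditions
  suffices for the trace to be a function of the public scalars and the program text, whichever
  commands take effect. In particular the index \<open>I\<close>, although public in the protocol, need not be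
  treated as such: inside an oblivious conditional its value depends on private data, but it is only
  ever used to access the ORAM.
\<close>

primrec oblivious_expr :: "'a set \<Rightarrow> ('v, 'a) expr \<Rightarrow> bool" where
  "oblivious_expr oram (Const c) \<longleftrightarrow> True"
| "oblivious_expr oram (Var x) \<longleftrightarrow> True"
| "oblivious_expr oram (Read A e) \<longleftrightarrow> A \<in> oram \<and> oblivious_expr oram e"
| "oblivious_expr oram (Arith f e1 e2) \<longleftrightarrow> oblivious_expr oram e1 \<and> oblivious_expr oram e2"

primrec oblivious_cond :: "'a set \<Rightarrow> ('v, 'a) cond \<Rightarrow> bool" where
  "oblivious_cond oram (Compare f e1 e2) \<longleftrightarrow> oblivious_expr oram e1 \<and> oblivious_expr oram e2"

text \<open>Array reads are excluded because agreement on \<open>P\<close> says nothing about array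
  contents.\<close>

primrec public_expr :: "'v set \<Rightarrow> ('v, 'a) expr \<Rightarrow> bool" where
  "public_expr P (Const c) \<longleftrightarrow> True"
| "public_expr P (Var x) \<longleftrightarrow> x \<in> P"
| "public_expr P (Read A e) \<longleftrightarrow> False"
| "public_expr P (Arith f e1 e2) \<longleftrightarrow> public_expr P e1 \<and> public_expr P e2"

primrec public_cond :: "'v set \<Rightarrow> ('v, 'a) cond \<Rightarrow> bool" where
  "public_cond P (Compare f e1 e2) \<longleftrightarrow> public_expr P e1 \<and> public_expr P e2"

text \<open>Scalars in \<open>P\<close> are read-only: under different flags even an assignment of a
  public value could take effect in one run only. The same bars them as loop counters, which a dummy
  run never sets. A sort reveals just array names and its range, so only the range is
  constrained.\<close>

primrec oblivious_com :: "'v set \<Rightarrow> 'a set \<Rightarrow> ('v, 'a) com \<Rightarrow> bool" where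
  "oblivious_com P oram Skip \<longleftrightarrow> True"
| "oblivious_com P oram (Assign x e) \<longleftrightarrow> x \<notin> P \<and> oblivious_expr oram e"
| "oblivious_com P oram (Store A i e) \<longleftrightarrow>
     A \<in> oram \<and> oblivious_expr oram i \<and> oblivious_expr oram e"
| "oblivious_com P oram (c1 ;; c2) \<longleftrightarrow> oblivious_com P oram c1 \<and> oblivious_com P oram c2"
| "oblivious_com P oram (If b c1 c2) \<longleftrightarrow>
     public_cond P b \<and> oblivious_com P oram c1 \<and> oblivious_com P oram c2"
| "oblivious_com P oram (ObliviousIf b c1 c2) \<longleftrightarrow>
     oblivious_cond oram b \<and> oblivious_com P oram c1 \<and> oblivious_com P oram c2"
| "oblivious_com P oram (For x lo hi c) \<longleftrightarrow>
     x \<notin> P \<and> public_expr P lo \<and> public_expr P hi \<and> oblivious_com P oram c"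
| "oblivious_com P oram (ObliviousSort A K lo hi) \<longleftrightarrow> public_expr P lo \<and> public_expr P hi"

text \<open>The low-equivalence of noninterference, with all arrays treated as secret.\<close>

definition public_eq :: "'v set \<Rightarrow> ('v, 'a) state \<Rightarrow> ('v, 'a) state \<Rightarrow> bool" where
  "public_eq P s s' \<longleftrightarrow> (\<forall>x\<in>P. scalars s x = scalars s' x)"

lemma public_eq_set_scalar [simp]:
  assumes "x \<notin> P"
  shows "public_eq P (set_scalar x k s) s' \<longleftrightarrow> public_eq P s s'"
    and "public_eq P s (set_scalar x k s') \<longleftrightarrow> public_eq P s s'"
  using assms by (auto simp: public_eq_def set_scalar_def)

lemma public_eq_set_cell [simp]:
  "public_eq P (set_cell A i k s) s' \<longleftrightarrow> public_eq P s s'"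
  "public_eq P s (set_cell A i k s') \<longleftrightarrow> public_eq P s s'"
  by (auto simp: public_eq_def set_cell_def)

lemma public_eq_sort_range [simp]:
  "public_eq P (sort_range srt A K lo hi s) s' \<longleftrightarrow> public_eq P s s'"
  "public_eq P s (sort_range srt A K lo hi s') \<longleftrightarrow> public_eq P s s'"
  by (auto simp: public_eq_def sort_range_def Let_def)

lemma eval_public_expr:
  "public_expr P e \<Longrightarrow> public_eq P s s' \<Longrightarrow> eval_expr e s = eval_expr e s'"
  by (induction e) (auto simp: public_eq_def)

lemma eval_public_cond:
  "public_cond P b \<Longrightarrow> public_eq P s s' \<Longrightarrow> eval_cond b s = eval_cond b s'"
  by (cases b) (simp add: eval_public_expr[of P _ s s'])

text \<open>Without reads there is no index to leak. \<open>If\<close> and \<open>For\<close> demand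
  publicness only, yet evaluating their guards and bounds is traced as well.\<close>

lemma public_imp_oblivious_expr: "public_expr P e \<Longrightarrow> oblivious_expr oram e"
  by (induction e) auto

lemma public_imp_oblivious_cond: "public_cond P b \<Longrightarrow> oblivious_cond oram b"
  by (cases b) (auto intro: public_imp_oblivious_expr)

text \<open>The states may be unrelated: an ORAM access hides its index, so the syntax alone fixes
  the events.\<close>

lemma trace_oblivious_expr:
  "oblivious_expr oram e \<Longrightarrow> trace_expr oram e s = trace_expr oram e s'"
  by (induction e) (auto simp: array_access_def)

lemma trace_oblivious_cond:
  "oblivious_cond oram b \<Longrightarrow> trace_cond oram b s = trace_cond oram b s'"
  by (cases b) (simp add: trace_oblivious_expr[of oram _ s s'])

text \<open>
  The flags of the two runs are independent, as inside an oblivious conditional they depend on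
  private data.
\<close>

lemma exec_oblivious_com:
  assumes "oblivious_com P oram c" and "public_eq P s s'"
  shows "public_eq P (fst (exec srt oram c act s)) (fst (exec srt oram c act' s')) \<and>
    snd (exec srt oram c act s) = snd (exec srt oram c act' s')"
  using assms
proof (induction c arbitrary: s s' act act')
  case Skip
  then show ?case by simp
next
  case (Assign x e)
  then show ?case by (auto intro: trace_oblivious_expr)
next
  case (Store A i e)
  then show ?case
    by (auto simp: array_access_def trace_oblivious_expr[of oram _ s s'])
next
  case (Seq c1 c2)
  have "public_eq P (fst (exec srt oram c1 act s)) (fst (exec srt oram c1 act' s'))"
    "snd (exec srt oram c1 act s) = snd (exec srt oram c1 act' s')"
    using Seq.IH(1)[of s s' act act'] Seq.prems by auto
  with Seq.IH(2)[of "fst (exec srt oram c1 act s)" "fst (exec srt oram c1 act' s')" act act']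
  show ?case using Seq.prems by (simp add: case_prod_beta Let_def)
next
  case (If b c1 c2)
  \<comment> \<open>Both runs thus take the same branch and emit the same \<open>Branch\<close>
    event.\<close>
  have "eval_cond b s = eval_cond b s'"
    using If.prems eval_public_cond by fastforce
  moreover have "trace_cond oram b s = trace_cond oram b s'"
    using If.prems by (auto intro: trace_oblivious_cond public_imp_oblivious_cond)
  ultimately show ?case
    using If.IH(1)[of s s' act act'] If.IH(2)[of s s' act act'] If.prems
    by (simp add: case_prod_beta Let_def)
next
  case (ObliviousIf b c1 c2)
  let ?r = "exec srt oram c1 (act \<and> eval_cond b s) s"
  let ?r' = "exec srt oram c1 (act' \<and> eval_cond b s') s'"
  \<comment> \<open>The secret guards may differ, but they only alter the flags; both branches are
    executed in either run.\<close>
  have "public_eq P (fst ?r) (fst ?r')" "snd ?r = snd ?r'"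
    using ObliviousIf.IH(1)[of s s' "act \<and> eval_cond b s" "act' \<and> eval_cond b s'"]
      ObliviousIf.prems by auto
  moreover have "trace_cond oram b s = trace_cond oram b s'"
    using ObliviousIf.prems by (auto intro: trace_oblivious_cond)
  ultimately show ?case
    using ObliviousIf.IH(2)[of "fst ?r" "fst ?r'" "act \<and> \<not> eval_cond b s" "act' \<and> \<not> eval_cond b s'"]
      ObliviousIf.prems
    by (simp add: case_prod_beta Let_def)
next
  case (For x lo hi c)
  \<comment> \<open>The flag is a parameter, so that both runs fold the same function.\<close>
  define step where "step = (\<lambda>act k (s1, t1).
      let (s2, t2) = exec srt oram c act (if act then set_scalar x k s1 else s1)
      in (s2, t1 @ [ScalarAccess x] @ t2))"
  \<comment> \<open>The accumulated trace \<open>t\<close> is general, since each iteration extends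
    it, but common to both runs.\<close>
  have loop: "public_eq P (fst (fold (step act) ks (s, t))) (fst (fold (step act') ks (s', t))) \<and>
      snd (fold (step act) ks (s, t)) = snd (fold (step act') ks (s', t))"
    if "public_eq P s s'" for ks s s' t
    using that
  proof (induction ks arbitrary: s s' t)
    case Nil
    then show ?case by simp
  next
    case (Cons k ks)
    let ?s = "if act then set_scalar x k s else s"
    let ?s' = "if act' then set_scalar x k s' else s'"
    \<comment> \<open>The counter may be set in one run only; this is harmless as \<open>x\<close>
      lies outside \<open>P\<close>.\<close>
    have "public_eq P ?s ?s'"
      using Cons.prems For.prems by auto
    with For.IH[of ?s ?s' act act'] For.prems
    have "public_eq P (fst (exec srt oram c act ?s)) (fst (exec srt oram c act' ?s'))"
      "snd (exec srt oram c act ?s) = snd (exec srt oram c act' ?s')" by auto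
    \<comment> \<open>Projections replace the pattern match, so that the two facts above rewrite one
      iteration.\<close>
    moreover have "step a k (r, t) =
        (let r' = if a then set_scalar x k r else r
         in (fst (exec srt oram c a r'), t @ [ScalarAccess x] @ snd (exec srt oram c a r')))" for a r
      by (simp add: step_def case_prod_beta Let_def)
    ultimately show ?case
      using Cons.IH by (simp add: Let_def split del: if_split)
  qed
  \<comment> \<open>Equal bounds make both runs fold over the same list, starting from the same
    trace.\<close>
  have "eval_expr lo s = eval_expr lo s'" "eval_expr hi s = eval_expr hi s'"
    "trace_expr oram lo s = trace_expr oram lo s'" "trace_expr oram hi s = trace_expr oram hi s'"
    using For.prems
    by (auto intro: eval_public_expr trace_oblivious_expr public_imp_oblivious_expr)
  then show ?case
    using loop[OF For.prems(2)] by (simp add: step_def)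
next
  case (ObliviousSort A K lo hi)
  then have "eval_expr lo s = eval_expr lo s'" "eval_expr hi s = eval_expr hi s'"
    "trace_expr oram lo s = trace_expr oram lo s'" "trace_expr oram hi s = trace_expr oram hi s'"
    by (auto intro: eval_public_expr trace_oblivious_expr public_imp_oblivious_expr)
  with ObliviousSort.prems show ?case by simp
qed

text \<open>Inputs of equal length start out agreeing on \<open>P\<close>; the invariant is then
  applied with both flags \<open>True\<close>.\<close>

lemma data_oblivious_if_oblivious_com:
  assumes "oblivious_com P oram c"
    and "\<And>l s s'. input l s \<Longrightarrow> input l s' \<Longrightarrow> public_eq P s s'"
  shows "data_oblivious srt oram input c"
  unfolding data_oblivious_def trace_def
  using exec_oblivious_com[OF assms(1)] assms(2) by blast

lemma oblivious_com_kshell_protocol: "oblivious_com {N, M} kshell_oram kshell_protocol"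
  by (simp add: kshell_protocol_def kshell_init_def kshell_degrees_def kshell_bins_def
      kshell_sort_def kshell_main_def kshell_decrease_def kshell_swap_def kshell_oram_def)

lemma kshell_input_public_eq:
  "kshell_input l s \<Longrightarrow> kshell_input l s' \<Longrightarrow> public_eq {N, M} s s'"
  by (cases l) (auto simp: kshell_input_def public_eq_def)

theorem theorem2:
  assumes "sorting_primitive srt"
  shows "data_oblivious srt kshell_oram kshell_input kshell_protocol"
  using oblivious_com_kshell_protocol kshell_input_public_eq
  by (rule data_oblivious_if_oblivious_com)

end
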